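(* Let $p\ge 5$ be a prime and let $n\ge 2$. The group $$G:=\langle x,y,z,\alpha_1,\dots,\alpha_{n-1},\beta_1,\dots,\beta_{n-1}\mid x^{p^n},\ y^{p^n},\ z^p,\ [x,y]=z,\ \alpha_i=x^{p^i},\ \beta_i=y^{p^i}\ (1\le i\le n-1)\rangle$$ is a non-abelian Beauville group of order $p^{2n+1}$.
   Context: Let $G$ be a finite group with identity $e$. For $x,y\in G$ put $$\Sigma(x,y):=\bigcup_{i=1}^{|G|}\bigcup_{g\in G}\{(x^i)^g,(y^i)^g,((xy)^i)^g\},$$ where $a^g$ denotes the conjugate $g^{-1}ag$. A Beauville structure for $G$ is a pair of generating sets $\{x_1,y_1\},\{x_2,y_2\}$ of $G$ (i.e. $\langle x_1,y_1\rangle=\langle x_2,y_2\rangle=G$) such that $\Sigma(x_1,y_1)\cap\Sigma(x_2,y_2)=\{e\}$. $G$ is a Beauville group if there exists a Beauville structure for $G$. Presentation conventions: $[a,b]=aba^{-1}b^{-1}$, and relations $[a,b]=e$ between commuting generators are omitted, i.e. any two generators whose commutator is not specified by a listed relation are understood to commute. Thus here all pairs of generators other than $(x,y)$ commute; in particular $z$, the $\alpha_i$ and the $\beta_i$ are central. *)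

theory Defs
  imports "HOL-Algebra.Generated_Groups" "HOL-Computational_Algebra.Primes"
begin

section \<open>Groups given by generators and relations\<close>

text \<open>
  A letter \<open>(a, True)\<close> stands for the generator \<open>a\<close>, and \<open>(a, False)\<close> for its formal inverse.
  A relation \<open>u = v\<close> between words is given as the pair \<open>(u, v)\<close>.
\<close>

type_synonym 'g word = "('g \<times> bool) list"

definition words :: "'g set \<Rightarrow> 'g word set" where
  "words S = lists (S \<times> UNIV)"

inductive_set pres_cong :: "'g set \<Rightarrow> ('g word \<times> 'g word) set \<Rightarrow> ('g word \<times> 'g word) set"
  for S :: "'g set" and R :: "('g word \<times> 'g word) set" where
  rel: "(u, v) \<in> R \<Longrightarrow> u \<in> words S \<Longrightarrow> v \<in> words S \<Longrightarrow> (u, v) \<in> pres_cong S R"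
| cancel: "a \<in> S \<Longrightarrow> ([(a, b), (a, \<not> b)], []) \<in> pres_cong S R"
| refl: "w \<in> words S \<Longrightarrow> (w, w) \<in> pres_cong S R"
| sym: "(u, v) \<in> pres_cong S R \<Longrightarrow> (v, u) \<in> pres_cong S R"
| trans: "(u, v) \<in> pres_cong S R \<Longrightarrow> (v, w) \<in> pres_cong S R \<Longrightarrow> (u, w) \<in> pres_cong S R"
| append: "(u, v) \<in> pres_cong S R \<Longrightarrow> (u', v') \<in> pres_cong S R \<Longrightarrow> (u @ u', v @ v') \<in> pres_cong S R"

definition presented_group :: "'g set \<Rightarrow> ('g word \<times> 'g word) set \<Rightarrow> 'g word set monoid" where
  "presented_group S R =
    \<lparr>carrier = words S // pres_cong S R,
     monoid.mult = (\<lambda>A B. \<Union>u\<in>A. \<Union>v\<in>B. pres_cong S R `` {u @ v}),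
     monoid.one = pres_cong S R `` {[]}\<rparr>"

lemma pres_cong_words:
  "(u, v) \<in> pres_cong S R \<Longrightarrow> u \<in> words S \<and> v \<in> words S"
  by (induction rule: pres_cong.induct) (auto simp: words_def)

lemma equiv_pres_cong: "equiv (words S) (pres_cong S R)"
proof (rule equivI)
  show "pres_cong S R \<subseteq> words S \<times> words S"
    using pres_cong_words by fast
  show "refl_on (words S) (pres_cong S R)"
    by (auto intro!: refl_onI pres_cong.refl)
  show "Relation.sym (pres_cong S R)"
    by (auto intro!: symI pres_cong.sym)
  show "Relation.trans (pres_cong S R)"
    by (rule transI) (rule pres_cong.trans)
qed

lemma mult_presented_group:
  assumes "u \<in> words S" "v \<in> words S"
  shows "(pres_cong S R `` {u}) \<otimes>\<^bsub>presented_group S R\<^esub> (pres_cong S R `` {v})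
          = pres_cong S R `` {u @ v}"
proof -
  have "congruent2 (pres_cong S R) (pres_cong S R) (\<lambda>u v. pres_cong S R `` {u @ v})"
  proof (rule congruent2I')
    fix y1 z1 y2 z2
    assume "(y1, z1) \<in> pres_cong S R" "(y2, z2) \<in> pres_cong S R"
    then show "pres_cong S R `` {y1 @ y2} = pres_cong S R `` {z1 @ z2}"
      by (intro equiv_class_eq[OF equiv_pres_cong] pres_cong.append)
  qed
  then show ?thesis
    using UN_equiv_class2[OF equiv_pres_cong equiv_pres_cong _ assms]
    by (simp add: presented_group_def)
qed

lemma inverse_word:
  assumes "w \<in> words S"
  shows "\<exists>w'\<in>words S. (w' @ w, []) \<in> pres_cong S R"
  using assms
proof (induction w)
  case Nil
  have "[] \<in> words S" by (simp add: words_def)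
  then show ?case by (auto intro!: pres_cong.refl bexI[of _ "[]"])
next
  case (Cons l w)
  obtain a b where l: "l = (a, b)" by (cases l)
  have a: "a \<in> S" and w: "w \<in> words S"
    using Cons.prems by (auto simp: l words_def)
  obtain w' where w': "w' \<in> words S" "(w' @ w, []) \<in> pres_cong S R"
    using Cons.IH w by blast
  have "([(a, \<not> b), (a, \<not> \<not> b)] @ w, [] @ w) \<in> pres_cong S R"
    using a w by (intro pres_cong.append pres_cong.cancel pres_cong.refl)
  then have "(w' @ ([(a, \<not> b), (a, b)] @ w), w' @ w) \<in> pres_cong S R"
    using pres_cong.append[OF pres_cong.refl[OF w'(1)]] by simp
  then have "((w' @ [(a, \<not> b)]) @ (l # w), []) \<in> pres_cong S R"
    using w'(2) by (auto simp: l intro: pres_cong.trans)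
  moreover have "w' @ [(a, \<not> b)] \<in> words S"
    using w'(1) a by (simp add: words_def)
  ultimately show ?case by blast
qed

lemma group_presented_group: "group (presented_group S R)"
proof -
  let ?G = "presented_group S R" and ?c = "\<lambda>u. pres_cong S R `` {u}"
  have carr: "carrier ?G = ?c ` words S"
    by (auto simp: presented_group_def quotient_def)
  have one: "\<one>\<^bsub>?G\<^esub> = ?c []" by (simp add: presented_group_def)
  have nil: "[] \<in> words S" by (simp add: words_def)
  have app: "u @ v \<in> words S" if "u \<in> words S" "v \<in> words S" for u v
    using that by (simp add: words_def)
  show ?thesis
  proof (rule groupI)
    fix x assume "x \<in> carrier ?G"
    then obtain u where u: "u \<in> words S" "x = ?c u" by (auto simp: carr)
    obtain u' where u': "u' \<in> words S" "(u' @ u, []) \<in> pres_cong S R"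
      using inverse_word[OF u(1)] by blast
    have "?c u' \<otimes>\<^bsub>?G\<^esub> x = \<one>\<^bsub>?G\<^esub>"
      using u u' by (simp add: mult_presented_group one equiv_class_eq[OF equiv_pres_cong])
    then show "\<exists>y\<in>carrier ?G. y \<otimes>\<^bsub>?G\<^esub> x = \<one>\<^bsub>?G\<^esub>"
      using u'(1) by (auto simp: carr)
  qed (auto simp: carr one nil app mult_presented_group)
qed


section \<open>Beauville groups\<close>

definition Sigma_set :: "('a, 'b) monoid_scheme \<Rightarrow> 'a \<Rightarrow> 'a \<Rightarrow> 'a set" where
  "Sigma_set G x y =
    (\<Union>i\<in>{1..order G}. \<Union>g\<in>carrier G.
      {inv\<^bsub>G\<^esub> g \<otimes>\<^bsub>G\<^esub> (x [^]\<^bsub>G\<^esub> i) \<otimes>\<^bsub>G\<^esub> g,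
       inv\<^bsub>G\<^esub> g \<otimes>\<^bsub>G\<^esub> (y [^]\<^bsub>G\<^esub> i) \<otimes>\<^bsub>G\<^esub> g,
       inv\<^bsub>G\<^esub> g \<otimes>\<^bsub>G\<^esub> ((x \<otimes>\<^bsub>G\<^esub> y) [^]\<^bsub>G\<^esub> i) \<otimes>\<^bsub>G\<^esub> g})"

definition beauville_structure ::
    "('a, 'b) monoid_scheme \<Rightarrow> 'a \<times> 'a \<Rightarrow> 'a \<times> 'a \<Rightarrow> bool" where
  "beauville_structure G = (\<lambda>(x1, y1) (x2, y2).
     x1 \<in> carrier G \<and> y1 \<in> carrier G \<and> x2 \<in> carrier G \<and> y2 \<in> carrier G \<and>
     generate G {x1, y1} = carrier G \<and> generate G {x2, y2} = carrier G \<and>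
     Sigma_set G x1 y1 \<inter> Sigma_set G x2 y2 = {\<one>\<^bsub>G\<^esub>})"

definition beauville_group :: "('a, 'b) monoid_scheme \<Rightarrow> bool" where
  "beauville_group G \<longleftrightarrow>
     group G \<and> finite (carrier G) \<and> (\<exists>P Q. beauville_structure G P Q)"


section \<open>The presentation\<close>

datatype gen = X | Y | Z | Alpha nat | Beta nat

definition gens :: "nat \<Rightarrow> gen set" where
  "gens n = {X, Y, Z} \<union> Alpha ` {1..n - 1} \<union> Beta ` {1..n - 1}"

definition gen_pow :: "'g \<Rightarrow> nat \<Rightarrow> 'g word" where
  "gen_pow a k = replicate k (a, True)"

text \<open>The commutator convention is \<open>[a, b] = a b a\<inverse> b\<inverse>\<close>.  The last set of relations
  below makes all pairs of generators other than \<open>X, Y\<close> commute; by convention these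
  relations are left out when the presentation is written down.\<close>

definition gen_comm :: "'g \<Rightarrow> 'g \<Rightarrow> 'g word" where
  "gen_comm a b = [(a, True), (b, True), (a, False), (b, False)]"

definition rels :: "nat \<Rightarrow> nat \<Rightarrow> (gen word \<times> gen word) set" where
  "rels p n =
     {(gen_pow X (p ^ n), []), (gen_pow Y (p ^ n), []), (gen_pow Z p, []),
      (gen_comm X Y, gen_pow Z 1)}
     \<union> {(gen_pow (Alpha i) 1, gen_pow X (p ^ i)) | i. i \<in> {1..n - 1}}
     \<union> {(gen_pow (Beta i) 1, gen_pow Y (p ^ i)) | i. i \<in> {1..n - 1}}
     \<union> {(gen_comm a b, []) | a b. a \<in> gens n \<and> b \<in> gens n \<and> {a, b} \<noteq> {X, Y}}"

definition beauville_pgroup :: "nat \<Rightarrow> nat \<Rightarrow> gen word set monoid" where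
  "beauville_pgroup p n = presented_group (gens n) (rels p n)"

end

theory Submission
  imports Defs "HOL-Number_Theory.Cong" "HOL-Algebra.Multiplicative_Group"
begin

text \<open>
  Every element of the group can be written as \<open>y\<^sup>b x\<^sup>a z\<^sup>c\<close>, and such products multiply as in the
  integer Heisenberg group: \<open>(a, b, c) (a', b', c') = (a + a', b + b', c + c' + a b')\<close>.  Evaluating
  words in the integer Heisenberg group respects the relations up to congruence modulo
  \<open>(p\<^sup>n, p\<^sup>n, p)\<close>, so the exponents are unique up to these congruences.  Hence the order is
  \<open>p\<^sup>2\<^sup>n\<^sup>+\<^sup>1\<close>.

  Conjugation changes only \<open>c\<close>, and \<open>g\<^sup>k = 1\<close> whenever \<open>p\<^sup>n\<close> divides \<open>k\<close>.  So if the images of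
  \<open>u\<close> and \<open>v\<close> in the abelianization have a determinant prime to \<open>p\<close>, then conjugates of powers
  of \<open>u\<close> and of \<open>v\<close> meet only in \<open>1\<close>.  For \<open>p \<ge> 5\<close> the projective line over the field of \<open>p\<close>
  elements has at least six points, enough for two generating pairs and their products.
\<close>

section \<open>Heisenberg relations\<close>

lemma (in group) conj_int_pow:
  assumes "g \<in> carrier G" "h \<in> carrier G"
  shows "g \<otimes> h [^] (k::int) \<otimes> inv g = (g \<otimes> h \<otimes> inv g) [^] k"
proof -
  have "(\<lambda>u. g \<otimes> u \<otimes> inv g) \<in> hom G G"
  proof (rule homI)
    fix u v assume "u \<in> carrier G" "v \<in> carrier G"
    then show "g \<otimes> (u \<otimes> v) \<otimes> inv g = g \<otimes> u \<otimes> inv g \<otimes> (g \<otimes> v \<otimes> inv g)"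
      using assms by (simp add: m_assoc) (simp add: m_assoc[symmetric])
  qed (use assms in auto)
  from hom_int_pow[OF this assms(2) is_group is_group] show ?thesis .
qed

lemma (in group) commute_int_pow:
  assumes "g \<otimes> h = h \<otimes> g" "g \<in> carrier G" "h \<in> carrier G"
  shows "g \<otimes> h [^] (k::int) = h [^] k \<otimes> g"
proof -
  have "g \<otimes> h \<otimes> inv g = h"
    using assms by (simp add: inv_solve_right')
  then have "g \<otimes> h [^] k \<otimes> inv g = h [^] k"
    using conj_int_pow assms by metis
  then show ?thesis
    using assms by (simp add: inv_solve_right')
qed

text \<open>As \<open>z\<close> commutes with \<open>x\<close> and \<open>y\<close>, the assumption
  \<open>x_y\<close> says \<open>[x, y] = z\<close>. No orders are fixed, so the lemmas here are
  identities valid in every image of the integer Heisenberg group.\<close>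

locale heisenberg_generators = group +
  fixes x y z
  assumes gen_closed [simp]: "x \<in> carrier G" "y \<in> carrier G" "z \<in> carrier G"
    and x_y: "x \<otimes> y = y \<otimes> x \<otimes> z"
    and x_z: "x \<otimes> z = z \<otimes> x"
    and y_z: "y \<otimes> z = z \<otimes> y"
begin

definition elt :: "int \<Rightarrow> int \<Rightarrow> int \<Rightarrow> 'a" where
  "elt a b c = y [^] b \<otimes> x [^] a \<otimes> z [^] c"

lemma elt_closed [simp]: "elt a b c \<in> carrier G"
  by (simp add: elt_def)

lemma z_pow_x_pow: "z [^] (c::int) \<otimes> x [^] (a::int) = x [^] a \<otimes> z [^] c"
  by (rule commute_int_pow) (simp_all add: commute_int_pow x_z)

lemma z_pow_y_pow: "z [^] (c::int) \<otimes> y [^] (b::int) = y [^] b \<otimes> z [^] c"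
  by (rule commute_int_pow) (simp_all add: commute_int_pow y_z)

text \<open>Conjugation by \<open>x\<close> sends \<open>y\<close> to \<open>y z\<close>, hence
  multiplies \<open>y [^] b\<close> by \<open>z [^] b\<close>. Read the other way, conjugation by
  the inverse of \<open>y [^] b\<close> multiplies \<open>x\<close> by \<open>z [^] b\<close>; then
  take the \<open>a\<close>-th power.\<close>

lemma x_pow_y_pow:
  "x [^] (a::int) \<otimes> y [^] (b::int) = y [^] b \<otimes> x [^] a \<otimes> z [^] (a * b)"
proof -
  have zb: "x \<otimes> z [^] b = z [^] b \<otimes> x"
    by (rule commute_int_pow) (simp_all add: x_z)
  have "x \<otimes> y \<otimes> inv x = y \<otimes> z"
    by (simp add: inv_solve_right' x_y x_z m_assoc)
  then have "x \<otimes> y [^] b \<otimes> inv x = y [^] b \<otimes> z [^] b"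
    by (simp add: conj_int_pow int_pow_mult_distrib y_z z_pow_y_pow)
  then have "x \<otimes> y [^] b = y [^] b \<otimes> z [^] b \<otimes> x"
    by (simp add: inv_solve_right')
  then have "x \<otimes> y [^] b = y [^] b \<otimes> (x \<otimes> z [^] b)"
    by (simp add: m_assoc zb)
  then have "inv (y [^] b) \<otimes> x \<otimes> inv (inv (y [^] b)) = x \<otimes> z [^] b"
    by (simp add: inv_solve_left' m_assoc)
  then have "inv (y [^] b) \<otimes> x [^] a \<otimes> inv (inv (y [^] b)) = x [^] a \<otimes> z [^] (b * a)"
    by (subst conj_int_pow) (simp_all add: int_pow_mult_distrib zb int_pow_pow z_pow_x_pow)
  then show ?thesis
    by (simp add: inv_solve_left' m_assoc mult.commute)
qed

lemma elt_mult:
  "elt a b c \<otimes> elt a' b' c' = elt (a + a') (b + b') (c + c' + a * b')"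
proof -
  have "elt a b c \<otimes> elt a' b' c' = y [^] b \<otimes> (x [^] a \<otimes> (z [^] c \<otimes> y [^] b')) \<otimes> x [^] a' \<otimes> z [^] c'"
    by (simp add: elt_def m_assoc)
  also have "\<dots> = y [^] b \<otimes> (x [^] a \<otimes> y [^] b') \<otimes> (z [^] c \<otimes> x [^] a') \<otimes> z [^] c'"
    by (simp add: z_pow_y_pow m_assoc)
  also have "\<dots> = y [^] b \<otimes> y [^] b' \<otimes> x [^] a \<otimes> (z [^] (a * b') \<otimes> x [^] a') \<otimes> z [^] c \<otimes> z [^] c'"
    by (simp only: x_pow_y_pow z_pow_x_pow[of c]) (simp add: m_assoc)
  also have "\<dots> = (y [^] b \<otimes> y [^] b') \<otimes> (x [^] a \<otimes> x [^] a') \<otimes> (z [^] (a * b') \<otimes> z [^] c \<otimes> z [^] c')"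
    by (simp only: z_pow_x_pow) (simp add: m_assoc)
  finally show ?thesis
    by (simp add: elt_def int_pow_mult[symmetric] ac_simps)
qed

lemma elt_0: "elt 0 0 0 = \<one>"
  by (simp add: elt_def)

lemma inv_elt: "inv (elt a b c) = elt (- a) (- b) (- c + a * b)"
  by (rule inv_equality) (simp_all add: elt_mult elt_0)

text \<open>Collecting \<open>k\<close> equal factors moves each \<open>x\<close> part past the
  \<open>y\<close> parts of all later factors, so every pair of factors adds \<open>a * b\<close> to
  the exponent of \<open>z\<close>.\<close>

lemma elt_pow:
  "elt a b c [^] (k::nat) =
    elt (int k * a) (int k * b) (int k * c + int (k choose 2) * (a * b))"
proof (induction k)
  case (Suc k)
  have "Suc k choose 2 = k + (k choose 2)"
    by (simp add: numeral_2_eq_2)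
  then show ?case
    by (simp add: Suc elt_mult algebra_simps)
qed (simp add: elt_0 numeral_2_eq_2)

lemma conj_elt:
  "inv (elt a' b' c') \<otimes> elt a b c \<otimes> elt a' b' c' = elt a b (c + a * b' - a' * b)"
  by (simp add: inv_elt elt_mult algebra_simps)

lemma gens_eq_elt: "x = elt 1 0 0" "y = elt 0 1 0" "z = elt 0 0 1"
  by (simp_all add: elt_def)

lemma elt_diag_int_pow:
  "elt a 0 0 [^] (k::int) = elt (k * a) 0 0"
  "elt 0 b 0 [^] (k::int) = elt 0 (k * b) 0"
  "elt 0 0 c [^] (k::int) = elt 0 0 (k * c)"
  by (simp_all add: elt_def int_pow_pow mult.commute)

end

section \<open>Beauville structures on quotients of the integer Heisenberg group\<close>

text \<open>Existence of normal forms and their uniqueness modulo \<open>(p ^ n, p ^ n, p)\<close>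
  are assumed here; the presentation supplies both at the end.\<close>

locale heisenberg_pgroup = heisenberg_generators +
  fixes p n :: nat
  assumes prime: "prime p" and p_ge: "p \<ge> 5" and n_ge: "n \<ge> 1"
    and elt_surj: "\<And>g. g \<in> carrier G \<Longrightarrow> \<exists>a b c. g = elt a b c"
    and elt_eq_iff: "\<And>a b c a' b' c'. elt a b c = elt a' b' c' \<longleftrightarrow>
      [a = a'] (mod int (p ^ n)) \<and> [b = b'] (mod int (p ^ n)) \<and> [c = c'] (mod int p)"
begin

section \<open>Order and non-commutativity\<close>

lemma carrier_eq_image:
  "carrier G = (\<lambda>(a, b, c). elt a b c) ` ({0..<int (p ^ n)} \<times> {0..<int (p ^ n)} \<times> {0..<int p})"
    (is "_ = ?f ` ?T")
proof
  show "carrier G \<subseteq> ?f ` ?T"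
  proof
    fix g assume "g \<in> carrier G"
    then obtain a b c where "g = elt a b c"
      using elt_surj by blast
    then have "g = ?f (a mod int (p ^ n), b mod int (p ^ n), c mod int p)"
      by (simp only: prod.case elt_eq_iff) (simp add: cong_def)
    moreover have "(a mod int (p ^ n), b mod int (p ^ n), c mod int p) \<in> ?T"
      using p_ge by simp
    ultimately show "g \<in> ?f ` ?T"
      by blast
  qed
qed auto

lemma finite_carrier: "finite (carrier G)"
  by (simp add: carrier_eq_image)

lemma order_eq: "order G = p ^ (2 * n + 1)"
proof -
  have "inj_on (\<lambda>(a, b, c). elt a b c) ({0..<int (p ^ n)} \<times> {0..<int (p ^ n)} \<times> {0..<int p})"
    by (auto simp: inj_on_def elt_eq_iff cong_def simp del: of_nat_power)
  then show ?thesis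
    by (simp add: order_def carrier_eq_image card_image card_cartesian_product power_add
        mult_2 nat_power_eq flip: of_nat_power)
qed

lemma not_comm: "\<not> comm_group G"
proof
  assume "comm_group G"
  then have "elt 1 0 0 \<otimes> elt 0 1 0 = elt 0 1 0 \<otimes> elt 1 0 0"
    by (simp add: comm_group_def comm_monoid.m_comm)
  then have "int p dvd 1"
    by (simp add: elt_mult elt_eq_iff cong_iff_dvd_diff)
  then show False
    using p_ge by simp
qed

section \<open>Powers, Sigma sets and their intersections\<close>

lemma elt_pow_eq_one:
  assumes "p ^ n dvd k"
  shows "elt a b c [^] (k::nat) = \<one>"
proof -
  \<comment> \<open>The exponent of \<open>z\<close> is
    \<open>k * c + (k choose 2) * (a * b)\<close>; as \<open>p\<close> is odd, it divides
    \<open>k choose 2\<close> along with \<open>k\<close>.\<close>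
  have pk: "p dvd k"
    using assms n_ge by (meson dvd_power dvd_trans less_le_trans zero_less_one)
  then have "p dvd k * (k - 1)"
    by simp
  also have "k * (k - 1) = 2 * (k choose 2)"
    using times_binomial_minus1_eq[of 2 k] by simp
  finally have "p dvd 2 \<or> p dvd k choose 2"
    using prime prime_dvd_mult_iff by blast
  moreover have "\<not> p dvd 2"
    using p_ge by (auto dest: dvd_imp_le)
  ultimately have "p dvd k choose 2"
    by simp
  with pk assms have "int p dvd int k" "int p dvd int (k choose 2)" "int (p ^ n) dvd int k"
    by presburger+
  then show ?thesis
    by (simp add: elt_pow elt_eq_iff cong_0_iff flip: elt_0)
qed

text \<open>Conjugation keeps the first two coordinates and shifts the third, hence the unspecified
  \<open>d\<close>. The clause on \<open>k\<close> lets a divisibility of the exponent alone force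
  \<open>h = \<one>\<close>.\<close>

lemma Sigma_set_elt:
  assumes "h \<in> Sigma_set G (elt a b 0) (elt a' b' 0)"
  shows "\<exists>k d. \<exists>(s, t) \<in> {(a, b), (a', b'), (a + a', b + b')}.
    h = elt (int k * s) (int k * t) d \<and> (p ^ n dvd k \<longrightarrow> h = \<one>)"
proof -
  have "elt a b 0 \<otimes> elt a' b' 0 = elt (a + a') (b + b') (a * b')"
    by (simp add: elt_mult)
  then obtain k g s t c where st: "(s, t) \<in> {(a, b), (a', b'), (a + a', b + b')}"
    and g: "g \<in> carrier G" and h: "h = inv g \<otimes> elt s t c [^] (k::nat) \<otimes> g"
    using assms unfolding Sigma_set_def by (auto; metis)
  obtain u v w where "g = elt u v w"
    using elt_surj g by blast
  with h obtain d where "h = elt (int k * s) (int k * t) d"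
    by (simp add: elt_pow conj_elt)
  moreover have "h = \<one>" if "p ^ n dvd k"
    using that g by (simp add: h elt_pow_eq_one)
  ultimately show ?thesis
    using st by blast
qed

lemma one_in_Sigma_set:
  assumes "g \<in> carrier G" "h \<in> carrier G"
  shows "\<one> \<in> Sigma_set G g h"
proof -
  \<comment> \<open>Exponents in \<open>Sigma_set\<close> start at 1, so \<open>\<one>\<close> is
    obtained as the power with exponent \<open>order G\<close>.\<close>
  have "order G \<in> {1..order G}"
    using finite_carrier order_gt_0_iff_finite by auto
  moreover have "\<one> = inv \<one> \<otimes> g [^] order G \<otimes> \<one>"
    using assms finite_carrier by (simp add: pow_order_eq_1)
  ultimately show ?thesis
    unfolding Sigma_set_def by blast
qed

lemma coprime_dvd_12:
  assumes "d dvd (12::int)"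
  shows "coprime d (int (p ^ n))"
proof -
  have "\<not> p dvd 2" "\<not> p dvd 3"
    using p_ge by (auto dest: dvd_imp_le)
  then have "\<not> p dvd 2 * (2 * 3)"
    using prime prime_dvd_mult_iff by blast
  then have "coprime (int p) (int 12)"
    using prime by (simp only: coprime_int_iff) (simp add: prime_imp_coprime)
  then show ?thesis
    using assms by (metis coprime_commute coprime_divisors coprime_power_right_iff dvd_refl of_nat_numeral of_nat_power)
qed

lemma Sigma_set_disjoint:
  assumes "\<And>s t s' t'. (s, t) \<in> {(a, b), (a', b'), (a + a', b + b')} \<Longrightarrow>
    (s', t') \<in> {(c, d), (c', d'), (c + c', d + d')} \<Longrightarrow> coprime (s * t' - t * s') (int (p ^ n))"
  shows "Sigma_set G (elt a b 0) (elt a' b' 0) \<inter> Sigma_set G (elt c d 0) (elt c' d' 0) = {\<one>}"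
proof -
  have "h = \<one>" if h1: "h \<in> Sigma_set G (elt a b 0) (elt a' b' 0)"
    and h2: "h \<in> Sigma_set G (elt c d 0) (elt c' d' 0)" for h
  proof -
    obtain k e s t where 1: "(s, t) \<in> {(a, b), (a', b'), (a + a', b + b')}"
        "h = elt (int k * s) (int k * t) e" "p ^ n dvd k \<longrightarrow> h = \<one>"
      using Sigma_set_elt[OF h1] by blast
    obtain l f s' t' where 2: "(s', t') \<in> {(c, d), (c', d'), (c + c', d + d')}"
        "h = elt (int l * s') (int l * t') f"
      using Sigma_set_elt[OF h2] by blast
    have "elt (int k * s) (int k * t) e = elt (int l * s') (int l * t') f"
      using 1(2) 2(2) by simp
    then have "int (p ^ n) dvd int k * s - int l * s'" "int (p ^ n) dvd int k * t - int l * t'"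
      by (simp_all only: elt_eq_iff cong_iff_dvd_diff simp_thms)
    \<comment> \<open>Taking the determinant with \<open>(s', t')\<close> eliminates
      \<open>l\<close> and leaves \<open>k\<close> times a number coprime to
      \<open>p ^ n\<close>.\<close>
    then have "int (p ^ n) dvd (int k * s - int l * s') * t' - (int k * t - int l * t') * s'"
      by (rule dvd_diff[OF dvd_mult2 dvd_mult2])
    also have "\<dots> = int k * (s * t' - t * s')"
      by (simp add: algebra_simps)
    finally have "int (p ^ n) dvd int k"
      using assms[OF 1(1) 2(1)] by (simp add: coprime_dvd_mult_left_iff coprime_commute)
    then show ?thesis
      using 1(3) by (simp only: of_nat_dvd_iff)
  qed
  then show ?thesis
    using one_in_Sigma_set by auto
qed

section \<open>Generating pairs\<close>

lemma subgroup_eq_carrier: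
  assumes "subgroup H G" "elt 1 0 0 \<in> H" "elt 0 1 0 \<in> H"
  shows "H = carrier G"
proof
  show "H \<subseteq> carrier G"
    using assms(1) by (rule subgroup.subset)
  \<comment> \<open>The commutator of \<open>x\<close> and \<open>y\<close> puts \<open>z\<close>
    into \<open>H\<close>, and with it every normal form.\<close>
  have "elt 1 0 0 \<otimes> elt 0 1 0 \<otimes> inv (elt 0 1 0 \<otimes> elt 1 0 0) \<in> H"
    using assms by (simp add: subgroup.m_closed subgroup.m_inv_closed)
  then have "elt 0 0 1 \<in> H"
    by (simp add: elt_mult inv_elt)
  with assms have "y [^] b \<otimes> x [^] a \<otimes> z [^] c \<in> H" for a b c :: int
    by (simp add: subgroup.m_closed subgroup_int_pow_closed flip: gens_eq_elt)
  then show "carrier G \<subseteq> H"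
    by (metis elt_surj elt_def subsetI)
qed

lemma generate_x_y: "generate G {elt 1 0 0, elt 0 1 0} = carrier G"
  by (rule subgroup_eq_carrier) (auto intro: generate_is_subgroup generate.incl)

text \<open>The commutator is \<open>z [^] (-2)\<close>, where \<open>-2\<close> is the determinant
  of the exponents. The vector \<open>(-2, -6)\<close> stands in place of \<open>(1, 3)\<close>,
  since the latter would give the product exponents \<open>(2, 5)\<close>, whose determinant 5 with
  \<open>(1, 0)\<close> fails for \<open>p = 5\<close>.\<close>

lemma generate_elt:
  "generate G {elt 1 2 0, elt (- 2) (- 6) 0} = carrier G" (is "?H = _")
proof (rule subgroup_eq_carrier)
  show H: "subgroup ?H G"
    by (rule generate_is_subgroup) auto
  note closed = subgroup.m_closed[OF H] subgroup.m_inv_closed[OF H] subgroup_int_pow_closed[OF H]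
  have u: "elt 1 2 0 \<in> ?H" and v: "elt (- 2) (- 6) 0 \<in> ?H"
    by (auto intro: generate.incl)
  have "elt 1 2 0 \<otimes> elt (- 2) (- 6) 0 \<otimes> inv (elt (- 2) (- 6) 0 \<otimes> elt 1 2 0) \<in> ?H"
    using u v by (intro closed)
  then have z2: "elt 0 0 (- 2) \<in> ?H"
    by (simp add: elt_mult inv_elt)
  \<comment> \<open>One inverse of \<open>-2\<close> serves twice: modulo \<open>p\<close> to
    extract \<open>z\<close>, modulo \<open>p ^ n\<close> to extract \<open>y\<close>.\<close>
  obtain m where m: "[- 2 * m = 1] (mod int (p ^ n))"
    using cong_solve_coprime_int[OF coprime_dvd_12[of "- 2"]] by auto
  then have mp: "[- 2 * m = 1] (mod int p)"
    by (rule cong_dvd_modulus) (use n_ge in simp)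
  have "elt 0 0 (- 2) [^] m \<in> ?H"
    by (rule closed(3)[OF z2])
  moreover have "elt 0 0 (- 2) [^] m = elt 0 0 1"
    using mp by (simp add: elt_diag_int_pow elt_eq_iff mult.commute)
  ultimately have z: "elt 0 0 1 \<in> ?H"
    by simp
  have zc: "elt 0 0 c \<in> ?H" for c
    using closed(3)[OF z, of c] by (simp add: elt_diag_int_pow)
  \<comment> \<open>With all powers of \<open>z\<close> available, the third coordinate can be
    changed at will.\<close>
  have adj: "elt a b c' \<in> ?H" if "elt a b c \<in> ?H" for a b c c'
    using closed(1)[OF that zc[of "c' - c"]] by (simp add: elt_mult)
  have "elt 1 2 0 \<otimes> elt 1 2 0 \<otimes> elt (- 2) (- 6) 0 \<in> ?H"
    using u v by (intro closed)
  then have "elt 0 (- 2) 0 \<in> ?H"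
    by (simp add: elt_mult adj)
  then have "elt 0 (- 2) 0 [^] m \<in> ?H"
    by (rule closed(3))
  moreover have "elt 0 (- 2) 0 [^] m = elt 0 1 0"
    using m by (simp add: elt_diag_int_pow elt_eq_iff mult.commute)
  ultimately show y: "elt 0 1 0 \<in> ?H"
    by simp
  have "elt 1 2 0 \<otimes> elt 0 1 0 [^] (- 2 :: int) \<in> ?H"
    using u y by (intro closed)
  then show "elt 1 0 0 \<in> ?H"
    by (simp add: elt_mult adj elt_diag_int_pow)
qed

text \<open>The first pair and its product have the slopes \<open>b / a = 0, \<infinity>, 1\<close>, the second pair and its
  product the slopes \<open>2, 3, 4\<close>; all the determinants that arise divide 12.\<close>

lemma beauville: "beauville_group G"
proof -
  have "Sigma_set G (elt 1 0 0) (elt 0 1 0) \<inter> Sigma_set G (elt 1 2 0) (elt (- 2) (- 6) 0) = {\<one>}"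
    by (rule Sigma_set_disjoint, rule coprime_dvd_12) auto
  then have "beauville_structure G (elt 1 0 0, elt 0 1 0) (elt 1 2 0, elt (- 2) (- 6) 0)"
    by (simp add: beauville_structure_def generate_x_y generate_elt)
  then show ?thesis
    using is_group finite_carrier unfolding beauville_group_def by blast
qed

end

section \<open>Words in the integer Heisenberg group\<close>

text \<open>The triple \<open>(a, b, c)\<close> stands for \<open>y\<^sup>b x\<^sup>a z\<^sup>c\<close>.\<close>

fun heis_mult :: "int \<times> int \<times> int \<Rightarrow> int \<times> int \<times> int \<Rightarrow> int \<times> int \<times> int" where
  "heis_mult (a, b, c) (a', b', c') = (a + a', b + b', c + c' + a * b')"

fun heis_inv :: "int \<times> int \<times> int \<Rightarrow> int \<times> int \<times> int" where
  "heis_inv (a, b, c) = (- a, - b, - c + a * b)"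

fun gen_val :: "nat \<Rightarrow> gen \<Rightarrow> int \<times> int \<times> int" where
  "gen_val p X = (1, 0, 0)"
| "gen_val p Y = (0, 1, 0)"
| "gen_val p Z = (0, 0, 1)"
| "gen_val p (Alpha i) = (int (p ^ i), 0, 0)"
| "gen_val p (Beta i) = (0, int (p ^ i), 0)"

fun word_val :: "nat \<Rightarrow> gen word \<Rightarrow> int \<times> int \<times> int" where
  "word_val p [] = (0, 0, 0)"
| "word_val p ((g, s) # w) =
    heis_mult (if s then gen_val p g else heis_inv (gen_val p g)) (word_val p w)"

text \<open>Equality in the quotient, kept as a relation on integer triples so that no quotient
  group has to be built.\<close>

fun heis_cong :: "nat \<Rightarrow> nat \<Rightarrow> int \<times> int \<times> int \<Rightarrow> int \<times> int \<times> int \<Rightarrow> bool" where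
  "heis_cong p n (a, b, c) (a', b', c') \<longleftrightarrow>
    [a = a'] (mod int (p ^ n)) \<and> [b = b'] (mod int (p ^ n)) \<and> [c = c'] (mod int p)"

lemma heis_mult_assoc: "heis_mult (heis_mult s t) u = heis_mult s (heis_mult t u)"
  by (cases s; cases t; cases u) (simp add: algebra_simps)

lemma word_val_append: "word_val p (u @ v) = heis_mult (word_val p u) (word_val p v)"
proof (induction u)
  case Nil
  show ?case by (cases "word_val p v") simp
next
  case (Cons l u)
  then show ?case by (cases l) (simp add: heis_mult_assoc)
qed

lemma word_val_replicate:
  "word_val p (replicate k (X, s)) = ((if s then int k else - int k), 0, 0)"
  "word_val p (replicate k (Y, s)) = (0, (if s then int k else - int k), 0)"
  "word_val p (replicate k (Z, s)) = (0, 0, (if s then int k else - int k))"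
  by (induction k) auto

text \<open>The product term \<open>a * b'\<close> in the third coordinate needs its factors only
  modulo \<open>p\<close>, and \<open>p\<close> divides \<open>p ^ n\<close>.\<close>

lemma heis_cong_mult:
  assumes "heis_cong p n s t" "heis_cong p n s' t'" "n \<ge> 1"
  shows "heis_cong p n (heis_mult s s') (heis_mult t t')"
proof -
  obtain a b c a' b' c' d e f d' e' f' where st: "s = (a, b, c)" "s' = (a', b', c')"
    "t = (d, e, f)" "t' = (d', e', f')"
    by (metis prod_cases3)
  have "int p dvd int (p ^ n)"
    using assms(3) by simp
  then have "[a * b' = d * e'] (mod int p)"
    using assms(1,2) by (auto simp: st intro: cong_mult cong_dvd_modulus)
  then show ?thesis
    using assms(1,2) by (simp add: st cong_add)
qed

lemma heis_cong_sym: "heis_cong p n s t \<Longrightarrow> heis_cong p n t s"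
  by (cases s; cases t) (simp add: cong_sym)

lemma heis_cong_trans: "heis_cong p n s t \<Longrightarrow> heis_cong p n t u \<Longrightarrow> heis_cong p n s u"
  by (cases s; cases t; cases u) (auto intro: cong_trans)

lemma heis_cong_rels:
  assumes "(u, v) \<in> rels p n"
  shows "heis_cong p n (word_val p u) (word_val p v)"
proof -
  \<comment> \<open>The critical pairs are such as \<open>Alpha i\<close> and \<open>Y\<close>:
    their commutator is \<open>z\<close> to the power \<open>p ^ i\<close>, trivial modulo
    \<open>p\<close> because \<open>i \<ge> 1\<close>.\<close>
  have comm: "heis_cong p n (word_val p (gen_comm a b)) (0, 0, 0)"
    if "a \<in> gens n" "b \<in> gens n" "{a, b} \<noteq> {X, Y}" for a b
    using that by (cases a; cases b)
      (auto simp: gen_comm_def gens_def cong_0_iff insert_commute algebra_simps)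
  consider "\<exists>a b. u = gen_comm a b \<and> v = [] \<and> a \<in> gens n \<and> b \<in> gens n \<and> {a, b} \<noteq> {X, Y}"
    | "u = gen_pow X (p ^ n)" "v = []" | "u = gen_pow Y (p ^ n)" "v = []"
    | "u = gen_pow Z p" "v = []" | "u = gen_comm X Y" "v = gen_pow Z 1"
    | i where "u = gen_pow (Alpha i) 1" "v = gen_pow X (p ^ i)"
    | i where "u = gen_pow (Beta i) 1" "v = gen_pow Y (p ^ i)"
    using assms unfolding rels_def by blast
  then show ?thesis
  proof cases
    case 1
    then show ?thesis using comm by fastforce
  qed (simp_all add: gen_pow_def gen_comm_def word_val_replicate cong_0_iff)
qed

text \<open>This bounds the group from below: the value up to congruence is an invariant of the
  class of a word, so the relations cause no further collapse.\<close>

lemma heis_cong_word_val: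
  assumes "n \<ge> 1" "(u, v) \<in> pres_cong (gens n) (rels p n)"
  shows "heis_cong p n (word_val p u) (word_val p v)"
  using assms(2)
proof induction
  case (rel u v)
  then show ?case by (simp add: heis_cong_rels)
next
  case (cancel a b)
  then show ?case by (cases "gen_val p a") auto
next
  case (refl w)
  show ?case by (cases "word_val p w") simp
next
  case (sym u v)
  show ?case by (rule heis_cong_sym) fact
next
  case (trans u v w)
  then show ?case by (blast intro: heis_cong_trans)
next
  case (append u v u' v')
  from append.IH assms(1) show ?case
    unfolding word_val_append by (rule heis_cong_mult)
qed

lemma ex_word_val:
  "\<exists>w \<in> words (gens n). word_val p w = (a, b, c)"
proof -
  \<comment> \<open>The Boolean of the letter carries the sign of the exponent.\<close>
  define pow where "pow g k = replicate (nat \<bar>k\<bar>) (g, k \<ge> 0)" for g :: gen and k :: int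
  have "pow Y b @ pow X a @ pow Z c \<in> words (gens n)"
    by (auto simp: pow_def words_def gens_def)
  moreover have "word_val p (pow Y b @ pow X a @ pow Z c) = (a, b, c)"
    by (simp add: pow_def word_val_append word_val_replicate)
  ultimately show ?thesis ..
qed

section \<open>Classes of words\<close>

definition word_class :: "'g set \<Rightarrow> ('g word \<times> 'g word) set \<Rightarrow> 'g word \<Rightarrow> 'g word set" where
  "word_class S R w = pres_cong S R `` {w}"

lemma carrier_presented_group: "carrier (presented_group S R) = word_class S R ` words S"
  by (auto simp: presented_group_def quotient_def word_class_def)

lemma word_class_closed: "w \<in> words S \<Longrightarrow> word_class S R w \<in> carrier (presented_group S R)"
  by (simp add: carrier_presented_group)

lemma word_class_append:
  "u \<in> words S \<Longrightarrow> v \<in> words S \<Longrightarrow>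
    word_class S R (u @ v) = word_class S R u \<otimes>\<^bsub>presented_group S R\<^esub> word_class S R v"
  by (simp add: word_class_def mult_presented_group)

lemma word_class_Nil: "word_class S R [] = \<one>\<^bsub>presented_group S R\<^esub>"
  by (simp add: word_class_def presented_group_def)

lemma word_class_eq_iff:
  "u \<in> words S \<Longrightarrow> v \<in> words S \<Longrightarrow>
    word_class S R u = word_class S R v \<longleftrightarrow> (u, v) \<in> pres_cong S R"
  unfolding word_class_def by (rule eq_equiv_class_iff[OF equiv_pres_cong])

lemma word_class_inverse:
  assumes "a \<in> S"
  shows "word_class S R [(a, False)] = inv\<^bsub>presented_group S R\<^esub> word_class S R [(a, True)]"
proof -
  interpret group "presented_group S R"
    by (rule group_presented_group)
  have w: "[(a, s)] \<in> words S" "[(a, s), (a, \<not> s)] \<in> words S" "[] \<in> words S" for s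
    using assms by (simp_all add: words_def)
  have "word_class S R ([(a, False)] @ [(a, True)]) = word_class S R []"
    using pres_cong.cancel[OF assms, of False R] w(2)[of False] w(3)
    by (simp add: word_class_eq_iff)
  then have "word_class S R [(a, False)] \<otimes>\<^bsub>presented_group S R\<^esub> word_class S R [(a, True)]
      = \<one>\<^bsub>presented_group S R\<^esub>"
    by (simp only: word_class_append w word_class_Nil)
  then show ?thesis
    using w by (simp add: inv_equality word_class_closed)
qed

lemma word_class_gen_pow:
  assumes "a \<in> S"
  shows "word_class S R (gen_pow a k) = word_class S R [(a, True)] [^]\<^bsub>presented_group S R\<^esub> k"
proof (induction k)
  case 0
  then show ?case by (simp add: gen_pow_def word_class_Nil)
next
  case (Suc k)
  have "gen_pow a (Suc k) = gen_pow a k @ [(a, True)]"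
    by (simp add: gen_pow_def replicate_append_same)
  moreover have "gen_pow a k \<in> words S" "[(a, True)] \<in> words S"
    using assms by (auto simp: gen_pow_def words_def)
  ultimately show ?case
    using Suc by (simp add: word_class_append)
qed

text \<open>In the form \<open>[a, b] b a = a b\<close>, a commutator relation becomes an exchange
  rule without inverses.\<close>

lemma word_class_gen_comm:
  assumes "a \<in> S" "b \<in> S"
  shows "word_class S R (gen_comm a b) \<otimes>\<^bsub>presented_group S R\<^esub>
      (word_class S R [(b, True)] \<otimes>\<^bsub>presented_group S R\<^esub> word_class S R [(a, True)]) =
    word_class S R [(a, True)] \<otimes>\<^bsub>presented_group S R\<^esub> word_class S R [(b, True)]"
proof -
  interpret group "presented_group S R"
    by (rule group_presented_group)
  have w: "[(a, s)] \<in> words S" "[(b, s)] \<in> words S" "[(a, s), (b, t)] \<in> words S" for s t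
    using assms by (simp_all add: words_def)
  have "gen_comm a b = ([(a, True)] @ [(b, True)]) @ ([(a, False)] @ [(b, False)])"
    by (simp add: gen_comm_def)
  also have "word_class S R \<dots> =
    (word_class S R [(a, True)] \<otimes>\<^bsub>presented_group S R\<^esub> word_class S R [(b, True)])
      \<otimes>\<^bsub>presented_group S R\<^esub>
    (inv\<^bsub>presented_group S R\<^esub> word_class S R [(a, True)]
      \<otimes>\<^bsub>presented_group S R\<^esub> inv\<^bsub>presented_group S R\<^esub> word_class S R [(b, True)])"
    by (subst word_class_append) (simp_all add: w word_class_append[where u = "[_]" and v = "[_]", simplified]
      word_class_inverse assms)
  finally show ?thesis
    using w by (simp add: inv_mult_group[symmetric] m_assoc word_class_closed)
qed

lemma word_class_rel:
  "(u, v) \<in> R \<Longrightarrow> u \<in> words S \<Longrightarrow> v \<in> words S \<Longrightarrow> word_class S R u = word_class S R v"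
  by (simp add: word_class_eq_iff pres_cong.rel)

section \<open>The presented group\<close>

locale beauville_presentation =
  fixes p n :: nat
  assumes prime: "prime p" and p_ge: "p \<ge> 5" and n_ge: "n \<ge> 1"
begin

abbreviation G where "G \<equiv> beauville_pgroup p n"
abbreviation cls where "cls \<equiv> word_class (gens n) (rels p n)"
abbreviation gcls where "gcls g \<equiv> cls [(g, True)]"

lemma gens_XYZ [simp]: "X \<in> gens n" "Y \<in> gens n" "Z \<in> gens n"
  by (simp_all add: gens_def)

lemma gen_words [simp]:
  assumes "g \<in> gens n"
  shows "[(g, s)] \<in> words (gens n)" "gen_pow g k \<in> words (gens n)"
  using assms by (auto simp: words_def gen_pow_def)

lemma Nil_words [simp]: "[] \<in> words (gens n)"
  by (simp add: words_def)

lemma gen_comm_words [simp]: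
  "a \<in> gens n \<Longrightarrow> b \<in> gens n \<Longrightarrow> gen_comm a b \<in> words (gens n)"
  by (simp add: words_def gen_comm_def)

lemma cls_closed [simp]: "w \<in> words (gens n) \<Longrightarrow> cls w \<in> carrier G"
  by (simp add: beauville_pgroup_def word_class_closed)

sublocale group G
  unfolding beauville_pgroup_def by (rule group_presented_group)

lemmas cls_append = word_class_append[of _ "gens n" _ "rels p n", folded beauville_pgroup_def]
lemmas cls_Nil = word_class_Nil[of "gens n" "rels p n", folded beauville_pgroup_def]
lemmas cls_inverse = word_class_inverse[of _ "gens n" "rels p n", folded beauville_pgroup_def]
lemmas cls_gen_pow = word_class_gen_pow[of _ "gens n" "rels p n", folded beauville_pgroup_def]
lemmas cls_gen_comm = word_class_gen_comm[of _ "gens n" _ "rels p n", folded beauville_pgroup_def]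
lemmas cls_rel = word_class_rel[of _ _ "rels p n" "gens n"]

section \<open>Normal forms in the presented group\<close>

lemma gcls_commute:
  assumes "a \<in> gens n" "b \<in> gens n" "{a, b} \<noteq> {X, Y}"
  shows "gcls a \<otimes>\<^bsub>G\<^esub> gcls b = gcls b \<otimes>\<^bsub>G\<^esub> gcls a"
proof -
  have "(gen_comm a b, []) \<in> rels p n"
    using assms by (auto simp: rels_def)
  then have "cls (gen_comm a b) = cls []"
    by (rule cls_rel) (simp_all add: assms)
  then have "cls (gen_comm a b) = \<one>\<^bsub>G\<^esub>"
    by (simp only: cls_Nil)
  then show ?thesis
    using cls_gen_comm[OF assms(1,2)] assms by simp
qed

lemma gcls_X_Y: "gcls X \<otimes>\<^bsub>G\<^esub> gcls Y = gcls Y \<otimes>\<^bsub>G\<^esub> gcls X \<otimes>\<^bsub>G\<^esub> gcls Z"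
proof -
  have "(gen_comm X Y, gen_pow Z 1) \<in> rels p n"
    by (simp add: rels_def)
  then have "cls (gen_comm X Y) = cls (gen_pow Z 1)"
    by (rule cls_rel) simp_all
  \<comment> \<open>The relation puts \<open>Z\<close> on the left; it is then moved past
    \<open>Y\<close> and \<open>X\<close> to the right.\<close>
  then have "gcls Z \<otimes>\<^bsub>G\<^esub> (gcls Y \<otimes>\<^bsub>G\<^esub> gcls X) = gcls X \<otimes>\<^bsub>G\<^esub> gcls Y"
    using cls_gen_comm[of X Y] by (simp add: gen_pow_def)
  moreover have "gcls Z \<otimes>\<^bsub>G\<^esub> (gcls Y \<otimes>\<^bsub>G\<^esub> gcls X) = gcls Y \<otimes>\<^bsub>G\<^esub> (gcls Z \<otimes>\<^bsub>G\<^esub> gcls X)"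
    using gcls_commute[of Z Y] by (simp add: doubleton_eq_iff flip: m_assoc)
  moreover have "gcls Z \<otimes>\<^bsub>G\<^esub> gcls X = gcls X \<otimes>\<^bsub>G\<^esub> gcls Z"
    by (rule gcls_commute) (auto simp: doubleton_eq_iff)
  ultimately show ?thesis
    by (simp add: m_assoc)
qed

sublocale heisenberg_generators G "gcls X" "gcls Y" "gcls Z"
  by unfold_locales
    (rule gcls_X_Y gcls_commute | simp add: doubleton_eq_iff)+

lemma gcls_eq_elt:
  assumes "g \<in> gens n" "gen_val p g = (a, b, c)"
  shows "gcls g = elt a b c"
proof -
  have Alpha: "gcls (Alpha i) = elt (int (p ^ i)) 0 0" if "Alpha i \<in> gens n" for i
  proof -
    have "(gen_pow (Alpha i) 1, gen_pow X (p ^ i)) \<in> rels p n"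
      using that by (auto simp: rels_def gens_def)
    then have "cls (gen_pow (Alpha i) 1) = cls (gen_pow X (p ^ i))"
      by (rule cls_rel) (simp_all add: that)
    then show ?thesis
      using that by (simp add: cls_gen_pow elt_def int_pow_int flip: int_pow_int of_nat_power)
  qed
  have Beta: "gcls (Beta i) = elt 0 (int (p ^ i)) 0" if "Beta i \<in> gens n" for i
  proof -
    have "(gen_pow (Beta i) 1, gen_pow Y (p ^ i)) \<in> rels p n"
      using that by (auto simp: rels_def gens_def)
    then have "cls (gen_pow (Beta i) 1) = cls (gen_pow Y (p ^ i))"
      by (rule cls_rel) (simp_all add: that)
    then show ?thesis
      using that by (simp add: cls_gen_pow elt_def int_pow_int flip: int_pow_int of_nat_power)
  qed
  show ?thesis
    using assms Alpha Beta gens_eq_elt by (cases g) auto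
qed

text \<open>This bounds the group from above: reading a word letter by letter,
  \<open>elt_mult\<close> and \<open>inv_elt\<close> follow the recursion of
  \<open>word_val\<close>.\<close>

lemma cls_eq_elt:
  assumes "w \<in> words (gens n)" "word_val p w = (a, b, c)"
  shows "cls w = elt a b c"
  using assms
proof (induction w arbitrary: a b c)
  case Nil
  then show ?case by (simp add: cls_Nil elt_0)
next
  case (Cons l w)
  obtain g s where l: "l = (g, s)" by (cases l)
  then have g: "g \<in> gens n" and w: "w \<in> words (gens n)"
    using Cons.prems(1) by (auto simp: words_def)
  obtain a1 b1 c1 a2 b2 c2 where v: "gen_val p g = (a1, b1, c1)" "word_val p w = (a2, b2, c2)"
    by (metis prod_cases3)
  have "cls (l # w) = cls [(g, s)] \<otimes>\<^bsub>G\<^esub> cls w"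
    using cls_append[of "[(g, s)]" w] g w l by simp
  then show ?case
    using Cons.prems(2) Cons.IH[OF w v(2)] gcls_eq_elt[OF g v(1)] v g
    by (cases s) (auto simp: l cls_inverse elt_mult inv_elt)
qed

lemma elt_eq_iff_cong:
  "elt a b c = elt a' b' c' \<longleftrightarrow>
    [a = a'] (mod int (p ^ n)) \<and> [b = b'] (mod int (p ^ n)) \<and> [c = c'] (mod int p)"
proof
  \<comment> \<open>Both triples are realized by words, and the invariant of these words is
    compared.\<close>
  assume eq: "elt a b c = elt a' b' c'"
  obtain u v where uv: "u \<in> words (gens n)" "word_val p u = (a, b, c)"
    "v \<in> words (gens n)" "word_val p v = (a', b', c')"
    using ex_word_val by metis
  then have "cls u = cls v"
    using eq cls_eq_elt by metis
  then have "(u, v) \<in> pres_cong (gens n) (rels p n)"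
    using uv by (simp add: word_class_eq_iff)
  from heis_cong_word_val[OF n_ge this] uv
  show "[a = a'] (mod int (p ^ n)) \<and> [b = b'] (mod int (p ^ n)) \<and> [c = c'] (mod int p)"
    by simp
next
  assume cong: "[a = a'] (mod int (p ^ n)) \<and> [b = b'] (mod int (p ^ n)) \<and> [c = c'] (mod int p)"
  \<comment> \<open>Conversely, the order relations for \<open>X\<close>, \<open>Y\<close> and
    \<open>Z\<close> allow each exponent to be reduced.\<close>
  have pow_eq: "gcls g [^]\<^bsub>G\<^esub> i = gcls g [^]\<^bsub>G\<^esub> j"
    if g: "g \<in> gens n" and rel: "(gen_pow g m, []) \<in> rels p n" and ij: "[i = j] (mod int m)"
    for g m and i j :: int
  proof -
    have "gcls g [^]\<^bsub>G\<^esub> int m = \<one>\<^bsub>G\<^esub>"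
      using cls_rel[OF rel] g by (simp add: cls_gen_pow cls_Nil int_pow_int)
    moreover obtain k where "j = i + int m * k"
      using ij by (auto simp: cong_iff_lin)
    ultimately show ?thesis
      using g by (simp add: int_pow_mult flip: int_pow_pow)
  qed
  have "gcls X [^]\<^bsub>G\<^esub> a = gcls X [^]\<^bsub>G\<^esub> a'"
    by (rule pow_eq[of _ "p ^ n"]) (use cong in \<open>simp_all add: rels_def\<close>)
  moreover have "gcls Y [^]\<^bsub>G\<^esub> b = gcls Y [^]\<^bsub>G\<^esub> b'"
    by (rule pow_eq[of _ "p ^ n"]) (use cong in \<open>simp_all add: rels_def\<close>)
  moreover have "gcls Z [^]\<^bsub>G\<^esub> c = gcls Z [^]\<^bsub>G\<^esub> c'"
    by (rule pow_eq[of _ p]) (use cong in \<open>simp_all add: rels_def\<close>)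
  ultimately show "elt a b c = elt a' b' c'"
    by (simp add: elt_def)
qed

sublocale heisenberg_pgroup G "gcls X" "gcls Y" "gcls Z" p n
proof
  fix g assume "g \<in> carrier G"
  then obtain w where w: "w \<in> words (gens n)" "g = cls w"
    by (auto simp: beauville_pgroup_def carrier_presented_group)
  then show "\<exists>a b c. g = elt a b c"
    using cls_eq_elt by (metis prod_cases3)
qed (use prime p_ge n_ge elt_eq_iff_cong in auto)

end

theorem lemma12:
  fixes p n :: nat
  assumes "prime p" and "p \<ge> 5" and "n \<ge> 2"
  shows "\<not> comm_group (beauville_pgroup p n)
    \<and> beauville_group (beauville_pgroup p n)
    \<and> order (beauville_pgroup p n) = p ^ (2 * n + 1)"
proof -
  interpret beauville_presentation p n
    using assms by unfold_locales auto
  show ?thesis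
    using not_comm beauville order_eq by blast
qed

end
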